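(* Let $X$ be a finite simplicial complex with connected 1-skeleton $G=(V,E)$ having at least one edge, let $T=(V,E_T)$ be a spanning tree of $G$ with root node $v_r$, and let $Z=\{\gamma(T,e): e\in E\setminus E_T\}$ be the associated set of 1-cycles. Let $y$ be a harmonic generated as the limit $y=\lim_{k\to\infty}y^k$ of the iteration $y^{k+1}=y^k-\delta L_1y^k$, where $y^0\in\mathbb{R}^{|E|}$ is a random vector with independent entries uniformly distributed on $[-0.5,0.5]$ and $0<\delta<2/\lambda$ for every positive eigenvalue $\lambda$ of $L_1$. Let $c\in Z$ and let $B=\mathrm{Img}(\partial_2)$. Then, with probability 1, $$c\in B\iff\langle y,c\rangle=0.$$
   Context: For $i=0,1,2$, $C_i$ is the real vector space with basis the $i$-simplices of $X$, each given a fixed arbitrary orientation by an ordering of its vertices (the oppositely oriented simplex is the additive inverse). The boundary operators are $\partial_i(v_{j_0},\ldots,v_{j_i})=\sum_{l=0}^{i}(-1)^l(v_{j_0},\ldots,\hat v_{j_l},\ldots,v_{j_i})$, identified with their matrices in the standard bases, so $C_1=\mathbb{R}^{|E|}$. The first combinatorial Laplacian is $L_1=\partial_2\partial_2^T+\partial_1^T\partial_1$; elements of $\ker(L_1)$ are called harmonics. $\langle\cdot,\cdot\rangle$ is the standard dot product on $C_1$. For a path $p=(e_{i_1}\cdots e_{i_k})$ in $G$, $\pi(p)=\sum_{j=1}^k\alpha_j\sigma_j\in C_1$, where $\sigma_j$ is the standard basis element supported on the edge $e_{i_j}$, and $\alpha_j=1$ if $\sigma_j$ has the same orientation as the direction in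 which the path traverses $e_{i_j}$, and $\alpha_j=-1$ otherwise. For $e=(v_1,v_2)\in E\setminus E_T$, let $p_1$ be the path in $T$ from $v_r$ to $v_1$ and $p_2$ the path in $T$ from $v_2$ to $v_r$; then $\gamma(T,e)=\pi(p_1,e,p_2)\in\ker(\partial_1)$. A cycle in $B$ is called contractible. *)

theory Defs
  imports "HOL-Probability.Probability" "HOL-Combinatorics.Permutations"
begin

section \<open>Simplicial complexes and oriented simplices\<close>

definition finite_simplicial_complex :: "'a set set \<Rightarrow> bool" where
  "finite_simplicial_complex X \<longleftrightarrow>
     finite X \<and> (\<forall>\<sigma>\<in>X. finite \<sigma> \<and> \<sigma> \<noteq> {}) \<and>
     (\<forall>\<sigma>\<in>X. \<forall>\<tau>. \<tau> \<subseteq> \<sigma> \<and> \<tau> \<noteq> {} \<longrightarrow> \<tau> \<in> X)"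

definition simplices :: "'a set set \<Rightarrow> nat \<Rightarrow> 'a set set" where
  "simplices X i = {\<sigma> \<in> X. card \<sigma> = i + 1}"

definition vertices :: "'a set set \<Rightarrow> 'a set" where
  "vertices X = {v. {v} \<in> X}"

definition edges :: "'a set set \<Rightarrow> 'a set set" where
  "edges X = simplices X 1"

definition orientation :: "'a set set \<Rightarrow> ('a set \<Rightarrow> 'a list) \<Rightarrow> bool" where
  "orientation X ord \<longleftrightarrow>
     (\<forall>i\<le>2. \<forall>\<sigma>\<in>simplices X i. distinct (ord \<sigma>) \<and> set (ord \<sigma>) = \<sigma>)"

section \<open>Chains, boundary operators and the first combinatorial Laplacian\<close>

text \<open>
  An element of \<open>C\<^sub>i\<close> is its coordinate function with respect to the basis of
  \<open>i\<close>-simplices, extended by zero. Operators are given by their matrices in these bases,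
  which are indexed by the simplices themselves.
\<close>

definition chain_space :: "'a set set \<Rightarrow> nat \<Rightarrow> ('a set \<Rightarrow> real) set" where
  "chain_space X i = {x. \<forall>\<sigma>. \<sigma> \<notin> simplices X i \<longrightarrow> x \<sigma> = 0}"

definition inner_chains :: "'a set set \<Rightarrow> ('a set \<Rightarrow> real) \<Rightarrow> ('a set \<Rightarrow> real) \<Rightarrow> real" where
  "inner_chains X x y = (\<Sum>e\<in>edges X. x e * y e)"

text \<open>
  The chain denoted by an ordered simplex \<open>(v\<^sub>0,\<dots>,v\<^sub>i)\<close>: the basis element on its vertex set,
  with the sign of the permutation taking the chosen ordering to the given one.
\<close>

definition ordered_simplex :: "('a set \<Rightarrow> 'a list) \<Rightarrow> 'a list \<Rightarrow> 'a set \<Rightarrow> real" where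
  "ordered_simplex ord vs = (\<lambda>\<tau>.
     if \<tau> = set vs
     then of_int (sign (THE p. p permutes {..<length vs} \<and> permute_list p (ord (set vs)) = vs))
     else 0)"

text \<open>Entry of the matrix of \<open>\<partial>\<^sub>i\<close> in row \<open>\<tau>\<close> (an \<open>i-1\<close>-simplex) and column \<open>\<sigma>\<close> (an \<open>i\<close>-simplex).\<close>

definition boundary_matrix :: "('a set \<Rightarrow> 'a list) \<Rightarrow> nat \<Rightarrow> 'a set \<Rightarrow> 'a set \<Rightarrow> real" where
  "boundary_matrix ord i \<tau> \<sigma> =
     (\<Sum>l\<le>i. (-1) ^ l * ordered_simplex ord (take l (ord \<sigma>) @ drop (Suc l) (ord \<sigma>)) \<tau>)"

text \<open>\<open>\<partial>\<^sub>i\<close> and its transpose, for \<open>i \<ge> 1\<close>.\<close>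

definition boundary ::
  "'a set set \<Rightarrow> ('a set \<Rightarrow> 'a list) \<Rightarrow> nat \<Rightarrow> ('a set \<Rightarrow> real) \<Rightarrow> 'a set \<Rightarrow> real" where
  "boundary X ord i x = (\<lambda>\<tau>.
     if \<tau> \<in> simplices X (i - 1)
     then (\<Sum>\<sigma>\<in>simplices X i. boundary_matrix ord i \<tau> \<sigma> * x \<sigma>) else 0)"

definition boundary_transpose ::
  "'a set set \<Rightarrow> ('a set \<Rightarrow> 'a list) \<Rightarrow> nat \<Rightarrow> ('a set \<Rightarrow> real) \<Rightarrow> 'a set \<Rightarrow> real" where
  "boundary_transpose X ord i x = (\<lambda>\<sigma>.
     if \<sigma> \<in> simplices X i
     then (\<Sum>\<tau>\<in>simplices X (i - 1). boundary_matrix ord i \<tau> \<sigma> * x \<tau>) else 0)"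

definition laplacian1 ::
  "'a set set \<Rightarrow> ('a set \<Rightarrow> 'a list) \<Rightarrow> ('a set \<Rightarrow> real) \<Rightarrow> 'a set \<Rightarrow> real" where
  "laplacian1 X ord x = (\<lambda>e.
     boundary X ord 2 (boundary_transpose X ord 2 x) e +
     boundary_transpose X ord 1 (boundary X ord 1 x) e)"

definition laplacian1_eigenvalue :: "'a set set \<Rightarrow> ('a set \<Rightarrow> 'a list) \<Rightarrow> real \<Rightarrow> bool" where
  "laplacian1_eigenvalue X ord \<mu> \<longleftrightarrow>
     (\<exists>x\<in>chain_space X 1. x \<noteq> (\<lambda>_. 0) \<and> laplacian1 X ord x = (\<lambda>e. \<mu> * x e))"

primrec laplacian1_iterate ::
  "'a set set \<Rightarrow> ('a set \<Rightarrow> 'a list) \<Rightarrow> real \<Rightarrow> ('a set \<Rightarrow> real) \<Rightarrow> nat \<Rightarrow> 'a set \<Rightarrow> real" where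
  "laplacian1_iterate X ord \<delta> y0 0 = y0"
| "laplacian1_iterate X ord \<delta> y0 (Suc k) = (\<lambda>e.
     laplacian1_iterate X ord \<delta> y0 k e
       - \<delta> * laplacian1 X ord (laplacian1_iterate X ord \<delta> y0 k) e)"

text \<open>
  The limit of the iteration, taken coordinatewise, which in the finite-dimensional space
  \<open>C\<^sub>1\<close> is the limit of vectors.
\<close>

definition generated_harmonic ::
  "'a set set \<Rightarrow> ('a set \<Rightarrow> 'a list) \<Rightarrow> real \<Rightarrow> ('a set \<Rightarrow> real) \<Rightarrow> 'a set \<Rightarrow> real" where
  "generated_harmonic X ord \<delta> y0 = (\<lambda>e. lim (\<lambda>k. laplacian1_iterate X ord \<delta> y0 k e))"

definition contractible_chains ::
  "'a set set \<Rightarrow> ('a set \<Rightarrow> 'a list) \<Rightarrow> ('a set \<Rightarrow> real) set" where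
  "contractible_chains X ord = boundary X ord 2 ` chain_space X 2"

section \<open>Paths, spanning trees and the associated cycles\<close>

text \<open>
  Graphs are undirected and simple, given by a vertex set and a set of two-element sets;
  a path is the list of vertices it visits, and \<open>[v]\<close> is the path without edges at \<open>v\<close>.
\<close>

definition is_walk :: "'a set \<Rightarrow> 'a set set \<Rightarrow> 'a list \<Rightarrow> bool" where
  "is_walk V F vs \<longleftrightarrow>
     vs \<noteq> [] \<and> set vs \<subseteq> V \<and> (\<forall>j. Suc j < length vs \<longrightarrow> {vs ! j, vs ! Suc j} \<in> F)"

definition is_path :: "'a set \<Rightarrow> 'a set set \<Rightarrow> 'a \<Rightarrow> 'a list \<Rightarrow> 'a \<Rightarrow> bool" where
  "is_path V F u vs v \<longleftrightarrow> is_walk V F vs \<and> distinct vs \<and> hd vs = u \<and> last vs = v"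

definition connected_graph :: "'a set \<Rightarrow> 'a set set \<Rightarrow> bool" where
  "connected_graph V F \<longleftrightarrow> V \<noteq> {} \<and> (\<forall>u\<in>V. \<forall>v\<in>V. \<exists>vs. is_path V F u vs v)"

definition acyclic_graph :: "'a set \<Rightarrow> 'a set set \<Rightarrow> bool" where
  "acyclic_graph V F \<longleftrightarrow>
     \<not> (\<exists>vs. is_walk V F vs \<and> distinct vs \<and> 3 \<le> length vs \<and> {last vs, hd vs} \<in> F)"

definition is_spanning_tree :: "'a set \<Rightarrow> 'a set set \<Rightarrow> 'a set set \<Rightarrow> bool" where
  "is_spanning_tree V E F \<longleftrightarrow> F \<subseteq> E \<and> connected_graph V F \<and> acyclic_graph V F"

definition tree_path :: "'a set \<Rightarrow> 'a set set \<Rightarrow> 'a \<Rightarrow> 'a \<Rightarrow> 'a list" where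
  "tree_path V F u v = (THE vs. is_path V F u vs v)"

definition path_chain :: "('a set \<Rightarrow> 'a list) \<Rightarrow> 'a list \<Rightarrow> 'a set \<Rightarrow> real" where
  "path_chain ord vs = (\<lambda>\<tau>. \<Sum>j<length vs - 1.
     if \<tau> = {vs ! j, vs ! Suc j}
     then (if ord \<tau> = [vs ! j, vs ! Suc j] then 1 else -1) else 0)"

text \<open>
  The edge \<open>e = (v\<^sub>1,v\<^sub>2)\<close> is read in its chosen orientation. Concatenating the vertex lists of
  \<open>p\<^sub>1\<close> (ending in \<open>v\<^sub>1\<close>) and \<open>p\<^sub>2\<close> (starting in \<open>v\<^sub>2\<close>) yields the path that traverses
  \<open>p\<^sub>1\<close>, \<open>e\<close>, \<open>p\<^sub>2\<close>.
\<close>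

definition fundamental_cycle ::
  "'a set set \<Rightarrow> ('a set \<Rightarrow> 'a list) \<Rightarrow> 'a set set \<Rightarrow> 'a \<Rightarrow> 'a set \<Rightarrow> 'a set \<Rightarrow> real" where
  "fundamental_cycle X ord F r e = path_chain ord
     (tree_path (vertices X) F r (ord e ! 0) @ tree_path (vertices X) F (ord e ! 1) r)"

definition fundamental_cycles ::
  "'a set set \<Rightarrow> ('a set \<Rightarrow> 'a list) \<Rightarrow> 'a set set \<Rightarrow> 'a \<Rightarrow> ('a set \<Rightarrow> real) set" where
  "fundamental_cycles X ord F r = {fundamental_cycle X ord F r e | e. e \<in> edges X - F}"

end

theory Submission
  imports Defs
begin

text \<open>
  The iteration converges to a harmonic chain \<open>y\<close> with \<open>y\<^sup>0 - y\<close> in the image of \<open>L\<^sub>1\<close>. Split the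
  cycle \<open>c\<close> as \<open>b + g\<close> with \<open>b \<in> B\<close> and \<open>g\<close> orthogonal to \<open>B\<close>; since \<open>\<partial>\<^sub>1 c = 0\<close> and
  \<open>\<partial>\<^sub>1 \<partial>\<^sub>2 = 0\<close>, \<open>g\<close> is harmonic. Harmonic chains are orthogonal to \<open>B\<close> and to the image of
  \<open>L\<^sub>1\<close>, so \<open>\<langle>y, c\<rangle> = \<langle>y, g\<rangle> = \<langle>y\<^sup>0, g\<rangle>\<close>. If \<open>c \<notin> B\<close>, then \<open>g \<noteq> 0\<close> and this is a nontrivial
  linear combination of independent variables without atoms, which almost surely does not vanish.
  For the convergence, let \<open>\<lambda>\<close> be the largest eigenvalue: the bound \<open>\<parallel>L x\<parallel>\<^sup>2 \<le> \<lambda> \<langle>x, L x\<rangle>\<close> gives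
  \<open>\<delta> (2 / \<lambda> - \<delta>) \<parallel>L x\<parallel>\<^sup>2 \<le> \<parallel>x\<parallel>\<^sup>2 - \<parallel>x - \<delta> L x\<parallel>\<^sup>2\<close>, so that \<open>\<parallel>L x\<parallel>\<^sup>2\<close> is summable along the
  iteration by telescoping.
\<close>

section \<open>Positive semidefinite matrices and gradient descent\<close>

text \<open>Vectors are total functions of which only the values on the index set count, because the
  index sets needed later are sets of simplices rather than types.\<close>

definition dot :: "'i set \<Rightarrow> ('i \<Rightarrow> real) \<Rightarrow> ('i \<Rightarrow> real) \<Rightarrow> real" where
  "dot I x y = (\<Sum>i\<in>I. x i * y i)"

definition mat_vec :: "'j set \<Rightarrow> ('i \<Rightarrow> 'j \<Rightarrow> real) \<Rightarrow> ('j \<Rightarrow> real) \<Rightarrow> 'i \<Rightarrow> real" where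
  "mat_vec J A x i = (\<Sum>j\<in>J. A i j * x j)"

definition sym_psd :: "'i set \<Rightarrow> ('i \<Rightarrow> 'i \<Rightarrow> real) \<Rightarrow> bool" where
  "sym_psd I A \<longleftrightarrow> (\<forall>i\<in>I. \<forall>j\<in>I. A i j = A j i) \<and> (\<forall>x. 0 \<le> dot I x (mat_vec I A x))"

section \<open>Bilinearity and adjoints\<close>

lemma dot_commute: "dot I x y = dot I y x"
  by (simp add: dot_def mult.commute)

lemma dot_add_left: "dot I (\<lambda>i. x i + y i) z = dot I x z + dot I y z"
  by (simp add: dot_def algebra_simps sum.distrib)

lemma dot_diff_left: "dot I (\<lambda>i. x i - y i) z = dot I x z - dot I y z"
  by (simp add: dot_def algebra_simps sum_subtractf)

lemma dot_scale_left: "dot I (\<lambda>i. t * x i) z = t * dot I x z"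
  by (simp add: dot_def sum_distrib_left mult.assoc)

lemma dot_add_right: "dot I z (\<lambda>i. x i + y i) = dot I z x + dot I z y"
  by (simp add: dot_def algebra_simps sum.distrib)

lemma dot_diff_right: "dot I z (\<lambda>i. x i - y i) = dot I z x - dot I z y"
  by (simp add: dot_def algebra_simps sum_subtractf)

lemma dot_scale_right: "dot I z (\<lambda>i. t * x i) = t * dot I z x"
  by (simp add: dot_def sum_distrib_left mult.left_commute)

lemmas dot_linear = dot_add_left dot_diff_left dot_scale_left
  dot_add_right dot_diff_right dot_scale_right

lemma dot_cong:
  "(\<And>i. i \<in> I \<Longrightarrow> x i = x' i) \<Longrightarrow> (\<And>i. i \<in> I \<Longrightarrow> y i = y' i) \<Longrightarrow> dot I x y = dot I x' y'"
  by (simp add: dot_def)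

lemma dot_self_nonneg: "0 \<le> dot I x x"
  by (simp add: dot_def sum_nonneg)

lemma dot_self_eq_0_iff: "finite I \<Longrightarrow> dot I x x = 0 \<longleftrightarrow> (\<forall>i\<in>I. x i = 0)"
  by (simp add: dot_def sum_nonneg_eq_0_iff)

lemma mat_vec_cong: "(\<And>j. j \<in> J \<Longrightarrow> x j = y j) \<Longrightarrow> mat_vec J A x = mat_vec J A y"
  by (simp add: mat_vec_def fun_eq_iff)

lemma mat_vec_add: "mat_vec J A (\<lambda>j. x j + y j) = (\<lambda>i. mat_vec J A x i + mat_vec J A y i)"
  by (simp add: mat_vec_def fun_eq_iff algebra_simps sum.distrib)

lemma mat_vec_diff: "mat_vec J A (\<lambda>j. x j - y j) = (\<lambda>i. mat_vec J A x i - mat_vec J A y i)"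
  by (simp add: mat_vec_def fun_eq_iff algebra_simps sum_subtractf)

lemma mat_vec_scale: "mat_vec J A (\<lambda>j. t * x j) = (\<lambda>i. t * mat_vec J A x i)"
  by (simp add: mat_vec_def fun_eq_iff sum_distrib_left mult.left_commute)

lemmas mat_vec_linear = mat_vec_add mat_vec_diff mat_vec_scale

lemma dot_mat_vec: "dot I x (mat_vec J A z) = dot J (mat_vec I (\<lambda>j i. A i j) x) z"
proof -
  have "dot I x (mat_vec J A z) = (\<Sum>i\<in>I. \<Sum>j\<in>J. A i j * x i * z j)"
    by (simp add: dot_def mat_vec_def sum_distrib_left mult_ac)
  also have "\<dots> = (\<Sum>j\<in>J. \<Sum>i\<in>I. A i j * x i * z j)"
    by (rule sum.swap)
  also have "\<dots> = dot J (mat_vec I (\<lambda>j i. A i j) x) z"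
    by (simp add: dot_def mat_vec_def sum_distrib_right)
  finally show ?thesis .
qed

lemma sym_psd_dot_mat_vec:
  assumes "sym_psd I A"
  shows "dot I x (mat_vec I A y) = dot I (mat_vec I A x) y"
  unfolding dot_mat_vec using assms
  by (auto intro!: dot_cong sum.cong simp: sym_psd_def mat_vec_def)

text \<open>Orthogonal projection of \<open>x\<close> onto the span of the columns of
  \<open>A\<close>, one column at a time as in Gram-Schmidt. The induction keeps \<open>x\<close>
  arbitrary since the new column has to be projected as well.\<close>

lemma normal_equations:
  fixes A :: "'i \<Rightarrow> 'j \<Rightarrow> real"
  assumes "finite I" "finite J"
  shows "\<exists>z. \<forall>j\<in>J. dot I (\<lambda>i. A i j) (\<lambda>i. x i - mat_vec J A z i) = 0"
  using assms(2)
proof (induction J arbitrary: x rule: finite_induct)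
  case empty
  then show ?case by simp
next
  case (insert k J)
  let ?col = "\<lambda>j i. A i j"
  have split: "mat_vec (insert k J) A z i = A i k * z k + mat_vec J A z i" for z i
    using insert.hyps by (simp add: mat_vec_def)
  obtain a where a: "\<And>j. j \<in> J \<Longrightarrow> dot I (?col j) (\<lambda>i. x i - mat_vec J A a i) = 0"
    using insert.IH[of x] by auto
  obtain b where b: "\<And>j. j \<in> J \<Longrightarrow> dot I (?col j) (\<lambda>i. ?col k i - mat_vec J A b i) = 0"
    using insert.IH[of "?col k"] by auto
  define r where "r = (\<lambda>i. x i - mat_vec J A a i)"
  define u where "u = (\<lambda>i. ?col k i - mat_vec J A b i)"
  have ortho: "dot I (mat_vec J A z) v = 0"
    if "\<And>j. j \<in> J \<Longrightarrow> dot I (?col j) v = 0" for z v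
  proof -
    have "dot I v (mat_vec J A z) = dot J (mat_vec I (\<lambda>j i. A i j) v) z"
      by (rule dot_mat_vec)
    also have "\<dots> = 0"
      using that by (simp add: dot_def mat_vec_def)
    finally show ?thesis by (simp add: dot_commute)
  qed
  \<comment> \<open>The multiple of \<open>u\<close> to be removed from \<open>r\<close>. If
    \<open>u\<close> vanishes on \<open>I\<close>, division by zero gives \<open>t = 0\<close> and
    \<open>tu\<close> still holds.\<close>
  define t where "t = dot I u r / dot I u u"
  have tu: "t * dot I u u = dot I u r"
  proof (cases "dot I u u = 0")
    case True
    then have "\<forall>i\<in>I. u i = 0" using \<open>finite I\<close> dot_self_eq_0_iff by blast
    then show ?thesis by (simp add: dot_def)
  qed (simp add: t_def)
  define z where "z = (\<lambda>j. if j = k then t else a j - t * b j)"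
  have z_eq: "x i - mat_vec (insert k J) A z i = r i - t * u i" for i
  proof -
    have "mat_vec J A z = mat_vec J A (\<lambda>j. a j - t * b j)"
      using insert.hyps by (intro mat_vec_cong) (auto simp: z_def)
    then show ?thesis
      unfolding split by (simp add: mat_vec_linear z_def r_def u_def algebra_simps)
  qed
  have J0: "dot I (?col j) (\<lambda>i. r i - t * u i) = 0" if "j \<in> J" for j
    using a[OF that] b[OF that] by (simp add: dot_linear r_def u_def)
  \<comment> \<open>The new column is \<open>u\<close> plus a combination of the old columns, and
    the residual is already orthogonal to the latter.\<close>
  have "dot I (?col k) (\<lambda>i. r i - t * u i) = dot I (\<lambda>i. u i + mat_vec J A b i) (\<lambda>i. r i - t * u i)"
    by (simp add: u_def)
  also have "\<dots> = dot I u (\<lambda>i. r i - t * u i)"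
    using ortho[OF J0, of b] by (simp add: dot_add_left)
  also have "\<dots> = 0"
    using tu by (simp add: dot_linear)
  finally have "\<forall>j\<in>insert k J. dot I (?col j) (\<lambda>i. r i - t * u i) = 0"
    using J0 by auto
  then show ?case
    unfolding z_eq[symmetric] by blast
qed

text \<open>The quadratic polynomial in \<open>t\<close> given by the form at \<open>x + t y\<close>
  is never negative. Semidefiniteness allows its leading coefficient to vanish, so that case is
  separate.\<close>

lemma sym_psd_Cauchy_Schwarz:
  assumes "sym_psd I A"
  shows "(dot I x (mat_vec I A y))\<^sup>2 \<le> dot I x (mat_vec I A x) * dot I y (mat_vec I A y)"
proof -
  let ?Q = "\<lambda>x y. dot I x (mat_vec I A y)"
  have nn: "0 \<le> ?Q v v" for v
    using assms by (simp add: sym_psd_def)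
  have sym: "?Q y x = ?Q x y"
    using sym_psd_dot_mat_vec[OF assms] by (metis dot_commute)
  have quad: "0 \<le> ?Q x x + 2 * t * ?Q x y + t\<^sup>2 * ?Q y y" for t
    using nn[of "\<lambda>i. x i + t * y i"] sym
    by (simp add: mat_vec_linear dot_linear power2_eq_square algebra_simps)
  show ?thesis
  proof (cases "?Q y y = 0")
    case True
    have "?Q x y = 0"
    proof (rule ccontr)
      assume ne: "?Q x y \<noteq> 0"
      \<comment> \<open>At this \<open>t\<close> the polynomial, now affine, takes the value
        -1.\<close>
      then have "2 * (- (?Q x x + 1) / (2 * ?Q x y)) * ?Q x y = - (?Q x x + 1)"
        by simp
      then show False
        using quad[of "- (?Q x x + 1) / (2 * ?Q x y)"] True by simp
    qed
    then show ?thesis using nn by simp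
  next
    case False
    then have pos: "0 < ?Q y y" using nn[of y] by simp
    \<comment> \<open>The value at the minimizer of the polynomial.\<close>
    have "?Q x x + 2 * (- ?Q x y / ?Q y y) * ?Q x y + (- ?Q x y / ?Q y y)\<^sup>2 * ?Q y y
        = ?Q x x - (?Q x y)\<^sup>2 / ?Q y y"
      using False by (simp add: power2_eq_square field_simps)
    then have "(?Q x y)\<^sup>2 / ?Q y y \<le> ?Q x x"
      using quad[of "- ?Q x y / ?Q y y"] by simp
    then show ?thesis using pos by (simp add: field_simps)
  qed
qed

text \<open>In the product topology the sphere is a closed part of the box \<open>?K\<close>, which
  is compact by Tychonoff's theorem: coordinates in \<open>I\<close> are bounded by 1 and all others
  are pinned to 0.\<close>

lemma compact_unit_sphere_functions:
  assumes "finite I"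
  shows "compact {x :: 'i \<Rightarrow> real. (\<forall>i. i \<notin> I \<longrightarrow> x i = 0) \<and> dot I x x = 1}" (is "compact ?S")
proof -
  let ?K = "Pi\<^sub>E UNIV (\<lambda>i. if i \<in> I then {-1..1} else {0 :: real})"
  have "compact ?K"
    unfolding compactin_euclidean_iff[symmetric] euclidean_product_topology[symmetric] compactin_PiE
    by auto
  moreover have "closed {x. dot I x x = 1}"
    unfolding dot_def
    by (intro closed_Collect_eq continuous_on_sum continuous_on_mult continuous_on_const
        continuous_on_product_coordinates)
  ultimately have "compact (?K \<inter> {x. dot I x x = 1})"
    by (rule compact_Int_closed)
  moreover have "?S = ?K \<inter> {x. dot I x x = 1}"
  proof (intro equalityI subsetI)
    fix x assume x: "x \<in> ?S"
    have "x i \<in> {-1..1}" if "i \<in> I" for i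
    proof -
      have "x i * x i \<le> dot I x x"
        unfolding dot_def using assms that by (intro member_le_sum) auto
      then have "(x i)\<^sup>2 \<le> 1" using x by (simp add: power2_eq_square)
      then show ?thesis by (simp add: abs_square_le_1 abs_le_iff)
    qed
    then show "x \<in> ?K \<inter> {x. dot I x x = 1}" using x by auto
  next
    fix x assume x: "x \<in> ?K \<inter> {x. dot I x x = 1}"
    have "x i = 0" if "i \<notin> I" for i
      using x that by (auto simp: PiE_iff dest!: spec[of _ i])
    then show "x \<in> ?S" using x by auto
  qed
  ultimately show ?thesis by simp
qed

text \<open>The Rayleigh quotient attains its maximum \<open>\<mu>\<close> on the compact unit
  sphere, and a maximizer is an eigenvector.\<close>

lemma sym_psd_largest_eigenvalue:
  assumes "finite I" "I \<noteq> {}" "sym_psd I A"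
  obtains \<mu> v where "\<And>x. dot I x (mat_vec I A x) \<le> \<mu> * dot I x x" "0 \<le> \<mu>"
    "dot I v v = 1" "\<And>i. i \<notin> I \<Longrightarrow> v i = 0" "\<And>i. i \<in> I \<Longrightarrow> mat_vec I A v i = \<mu> * v i"
proof -
  let ?S = "{x :: 'a \<Rightarrow> real. (\<forall>i. i \<notin> I \<longrightarrow> x i = 0) \<and> dot I x x = 1}"
  let ?Q = "\<lambda>x. dot I x (mat_vec I A x)"
  obtain i0 where i0: "i0 \<in> I" using assms by auto
  have "(\<lambda>i. if i = i0 then 1 else 0) \<in> ?S"
    using i0 assms(1) by (auto simp: dot_def if_distrib cong: if_cong)
  then have ne: "?S \<noteq> {}" by (rule ex_in_conv[THEN iffD1, OF exI])
  have "continuous_on UNIV ?Q"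
    unfolding dot_def mat_vec_def
    by (intro continuous_on_sum continuous_on_mult continuous_on_const
        continuous_on_product_coordinates)
  then have cont: "continuous_on ?S ?Q"
    by (rule continuous_on_subset) simp
  from continuous_attains_sup[OF compact_unit_sphere_functions[OF assms(1)] ne cont]
  obtain v where v: "v \<in> ?S" "\<forall>x\<in>?S. ?Q x \<le> ?Q v"
    by (rule bexE)
  define \<mu> where "\<mu> = ?Q v"
  have bound: "?Q x \<le> \<mu> * dot I x x" for x
  proof (cases "dot I x x = 0")
    case True
    then have "\<forall>i\<in>I. x i = 0" using assms(1) dot_self_eq_0_iff by blast
    then show ?thesis by (simp add: dot_def)
  next
    case False
    then have pos: "0 < dot I x x" using dot_self_nonneg[of I x] by simp
    define t where "t = 1 / sqrt (dot I x x)"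
    have tt: "t * t * dot I x x = 1"
      using pos by (simp add: t_def)
    \<comment> \<open>Besides rescaling \<open>x\<close>, this cuts off its values outside
      \<open>I\<close>, which leaves the form unchanged.\<close>
    let ?y = "\<lambda>i. if i \<in> I then t * x i else 0"
    have Iy: "mat_vec I A ?y = mat_vec I A (\<lambda>i. t * x i)" by (rule mat_vec_cong) simp
    have "dot I ?y ?y = dot I (\<lambda>i. t * x i) (\<lambda>i. t * x i)" by (rule dot_cong) auto
    also have "\<dots> = 1" using tt by (simp add: dot_linear mult.assoc)
    finally have "?Q ?y \<le> \<mu>" using bspec[OF v(2), of ?y] by (simp add: \<mu>_def)
    moreover have "?Q ?y = dot I (\<lambda>i. t * x i) (mat_vec I A (\<lambda>i. t * x i))"
      unfolding Iy by (rule dot_cong) auto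
    ultimately have "t * t * ?Q x \<le> \<mu>" by (simp add: mat_vec_linear dot_linear mult.assoc)
    then have "t * t * ?Q x * dot I x x \<le> \<mu> * dot I x x"
      using pos by (intro mult_right_mono) auto
    moreover have "t * t * ?Q x * dot I x x = ?Q x"
      using tt by (metis mult.commute mult.left_commute mult_1)
    ultimately show ?thesis by simp
  qed
  \<comment> \<open>\<open>\<mu>\<close> times the identity minus \<open>A\<close> is positive
    semidefinite by maximality, and its form vanishes at \<open>v\<close>. By Cauchy-Schwarz it then
    annihilates \<open>v\<close>.\<close>
  let ?A = "\<lambda>i j. (if i = j then \<mu> else 0) - A i j"
  have mv: "mat_vec I ?A x i = \<mu> * x i - mat_vec I A x i" if "i \<in> I" for x i
    using that assms(1)
    by (simp add: mat_vec_def left_diff_distrib sum_subtractf if_distrib[where f = "\<lambda>a. a * _"] cong: if_cong)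
  have Q': "dot I x (mat_vec I ?A y) = \<mu> * dot I x y - dot I x (mat_vec I A y)" for x y
  proof -
    have "dot I x (mat_vec I ?A y) = dot I x (\<lambda>i. \<mu> * y i - mat_vec I A y i)"
      by (rule dot_cong) (auto simp: mv)
    then show ?thesis by (simp add: dot_linear)
  qed
  have psd': "sym_psd I ?A"
    using assms(3) bound Q' by (auto simp: sym_psd_def)
  let ?w = "mat_vec I ?A v"
  have "dot I v ?w = 0" using Q'[of v v] v(1) by (simp add: \<mu>_def)
  then have "(dot I ?w ?w)\<^sup>2 \<le> 0"
    using sym_psd_Cauchy_Schwarz[OF psd', of ?w v] by simp
  then have "\<forall>i\<in>I. ?w i = 0" using dot_self_eq_0_iff[OF assms(1)] by simp
  then have eig: "mat_vec I A v i = \<mu> * v i" if "i \<in> I" for i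
    using that mv[OF that, of v] by simp
  have "0 \<le> \<mu>" using assms(3) by (simp add: sym_psd_def \<mu>_def)
  then show thesis
    by (rule that[OF bound _ _ _ eig]) (use v(1) in auto)
qed

text \<open>Takes the place of a spectral decomposition. Cauchy-Schwarz for the form of
  \<open>A\<close> at \<open>A x\<close> and \<open>x\<close> bounds the fourth power of the norm of
  \<open>A x\<close> by \<open>\<mu>\<close> times its square times
  \<open>dot I x (mat_vec I A x)\<close>, and one square cancels.\<close>

lemma sym_psd_image_bound:
  assumes "sym_psd I A" "\<And>x. dot I x (mat_vec I A x) \<le> \<mu> * dot I x x" "0 \<le> \<mu>"
  shows "dot I (mat_vec I A x) (mat_vec I A x) \<le> \<mu> * dot I x (mat_vec I A x)"
proof -
  let ?w = "mat_vec I A x"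
  have q: "0 \<le> dot I x ?w" using assms(1) by (simp add: sym_psd_def)
  have "(dot I ?w ?w)\<^sup>2 \<le> dot I ?w (mat_vec I A ?w) * dot I x ?w"
    by (rule sym_psd_Cauchy_Schwarz[OF assms(1)])
  also have "\<dots> \<le> \<mu> * dot I ?w ?w * dot I x ?w"
    by (intro mult_right_mono assms(2) q)
  finally have *: "dot I ?w ?w * dot I ?w ?w \<le> dot I ?w ?w * (\<mu> * dot I x ?w)"
    by (simp add: power2_eq_square mult_ac)
  show ?thesis
  proof (cases "dot I ?w ?w = 0")
    case True
    then show ?thesis using q assms(3) by simp
  next
    case False
    then show ?thesis using * dot_self_nonneg[of I ?w] by simp
  qed
qed

text \<open>Only the images of the iterates under \<open>A\<close> are treated here. Convergence of
  the iteration itself follows by applying this to a sequence whose images are its non-harmonic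
  parts.\<close>

lemma gradient_descent_image_tendsto_0:
  assumes "finite I" "sym_psd I A"
    and \<delta>: "0 < \<delta>"
      "\<And>\<mu> v. dot I v v = 1 \<Longrightarrow> (\<And>i. i \<notin> I \<Longrightarrow> v i = 0) \<Longrightarrow>
         (\<And>i. i \<in> I \<Longrightarrow> mat_vec I A v i = \<mu> * v i) \<Longrightarrow> 0 < \<mu> \<Longrightarrow> \<delta> < 2 / \<mu>"
    and step: "\<And>k i. i \<in> I \<Longrightarrow> a (Suc k) i = a k i - \<delta> * mat_vec I A (a k) i"
    and "i \<in> I"
  shows "(\<lambda>k. mat_vec I A (a k) i) \<longlonglongrightarrow> 0"
proof -
  obtain \<mu> v where \<mu>: "\<And>x. dot I x (mat_vec I A x) \<le> \<mu> * dot I x x" "0 \<le> \<mu>"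
    and v: "dot I v v = 1" "\<And>i. i \<notin> I \<Longrightarrow> v i = 0" "\<And>i. i \<in> I \<Longrightarrow> mat_vec I A v i = \<mu> * v i"
    using sym_psd_largest_eigenvalue[OF assms(1) _ assms(2)] \<open>i \<in> I\<close> by blast
  let ?L = "mat_vec I A"
  let ?n = "\<lambda>x. dot I x x"
  have img: "?n (?L x) \<le> \<mu> * dot I x (?L x)" for x
    by (rule sym_psd_image_bound[OF assms(2) \<mu>])
  have lim: "(\<lambda>k. ?n (?L (a k))) \<longlonglongrightarrow> 0"
  proof (cases "\<mu> = 0")
    \<comment> \<open>If the largest eigenvalue is 0, no bound on \<open>\<delta>\<close> is
      available, but every image under \<open>A\<close> vanishes on \<open>I\<close>.\<close>
    case True
    then have "?n (?L (a k)) = 0" for k using img[of "a k"] dot_self_nonneg[of I "?L (a k)"] by simp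
    then show ?thesis by simp
  next
    case False
    then have pos: "0 < \<mu>" using \<mu>(2) by simp
    \<comment> \<open>Given \<open>0 < \<delta>\<close>, the step size bound at the largest
      eigenvalue says exactly that \<open>q\<close> is positive.\<close>
    define q where "q = \<delta> * (2 / \<mu> - \<delta>)"
    have q: "0 < q" using \<delta>(1) \<delta>(2)[OF v pos] by (simp add: q_def)
    have dec: "q * ?n (?L (a k)) \<le> ?n (a k) - ?n (a (Suc k))" for k
    proof -
      have "?n (a (Suc k)) = ?n (\<lambda>i. a k i - \<delta> * ?L (a k) i)"
        by (rule dot_cong) (auto simp: step)
      also have "\<dots> = ?n (a k) - 2 * \<delta> * dot I (a k) (?L (a k)) + \<delta>\<^sup>2 * ?n (?L (a k))"
        using dot_commute[of I "?L (a k)" "a k"]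
        by (simp add: dot_linear power2_eq_square algebra_simps)
      finally have e: "?n (a k) - ?n (a (Suc k))
          = 2 * \<delta> * dot I (a k) (?L (a k)) - \<delta>\<^sup>2 * ?n (?L (a k))" by simp
      have "?n (?L (a k)) / \<mu> \<le> dot I (a k) (?L (a k))"
        using img[of "a k"] pos by (simp add: field_simps)
      then have "2 * \<delta> * (?n (?L (a k)) / \<mu>) \<le> 2 * \<delta> * dot I (a k) (?L (a k))"
        using \<delta>(1) by (intro mult_left_mono) auto
      then show ?thesis
        unfolding e q_def by (simp add: power2_eq_square algebra_simps)
    qed
    have "(\<Sum>k<m. q * ?n (?L (a k))) \<le> ?n (a 0)" for m
    proof -
      have "(\<Sum>k<m. q * ?n (?L (a k))) \<le> (\<Sum>k<m. ?n (a k) - ?n (a (Suc k)))"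
        by (intro sum_mono dec)
      also have "\<dots> = ?n (a 0) - ?n (a m)" by (rule sum_lessThan_telescope')
      finally show ?thesis using dot_self_nonneg[of I "a m"] by simp
    qed
    then have "summable (\<lambda>k. q * ?n (?L (a k)))"
      using q by (intro summableI_nonneg_bounded[of _ "?n (a 0)"]) (auto simp: dot_self_nonneg)
    then have "summable (\<lambda>k. ?n (?L (a k)))" using q by (simp add: summable_cmult_iff)
    then show ?thesis by (rule summable_LIMSEQ_zero)
  qed
  have le: "(?L (a k) i)\<^sup>2 \<le> ?n (?L (a k))" for k
    unfolding dot_def power2_eq_square using assms(1) \<open>i \<in> I\<close> by (intro member_le_sum) auto
  have "(\<lambda>k. (?L (a k) i)\<^sup>2) \<longlonglongrightarrow> 0"
    by (rule real_tendsto_sandwich[OF _ _ tendsto_const lim]) (use le in auto)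
  then show ?thesis by simp
qed

text \<open>
  Splitting the starting vector as \<open>h + A u\<close> with \<open>A h = 0\<close>, the iteration fixes \<open>h\<close> and
  maps \<open>A u\<close> to \<open>A\<close> applied to the iterates of \<open>u\<close>.
\<close>

lemma gradient_descent_limit:
  assumes "finite I" "sym_psd I A"
    and \<delta>: "0 < \<delta>"
      "\<And>\<mu> v. dot I v v = 1 \<Longrightarrow> (\<And>i. i \<notin> I \<Longrightarrow> v i = 0) \<Longrightarrow>
         (\<And>i. i \<in> I \<Longrightarrow> mat_vec I A v i = \<mu> * v i) \<Longrightarrow> 0 < \<mu> \<Longrightarrow> \<delta> < 2 / \<mu>"
    and step: "\<And>k i. i \<in> I \<Longrightarrow> y (Suc k) i = y k i - \<delta> * mat_vec I A (y k) i"
  shows "\<exists>h u. \<forall>i\<in>I. (\<lambda>k. y k i) \<longlonglongrightarrow> h i \<and> mat_vec I A h i = 0 \<and> y 0 i = h i + mat_vec I A u i"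
proof -
  let ?L = "mat_vec I A"
  obtain u where u: "\<forall>j\<in>I. dot I (\<lambda>i. A i j) (\<lambda>i. y 0 i - ?L u i) = 0"
    using normal_equations[OF assms(1,1)] by blast
  \<comment> \<open>This residual is orthogonal to the columns of \<open>A\<close>, which by
    symmetry are its rows, so \<open>A\<close> annihilates it.\<close>
  define h where "h = (\<lambda>i. y 0 i - ?L u i)"
  have h: "?L h i = 0" if "i \<in> I" for i
  proof -
    have "?L h i = dot I (\<lambda>j. A j i) h"
      using assms(2) that by (simp add: dot_def mat_vec_def sym_psd_def)
    then show ?thesis using u that by (simp add: h_def)
  qed
  \<comment> \<open>The same iteration started at \<open>u\<close>; each of its steps commutes with
    \<open>A\<close>.\<close>
  define a where "a = rec_nat u (\<lambda>_ x i. x i - \<delta> * ?L x i)"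
  have a: "a 0 = u" "a (Suc k) = (\<lambda>i. a k i - \<delta> * ?L (a k) i)" for k
    by (simp_all add: a_def)
  have y: "y k i = h i + ?L (a k) i" if "i \<in> I" for k i
    using that
  proof (induction k arbitrary: i)
    case 0
    then show ?case by (simp add: a h_def)
  next
    case (Suc k)
    have "?L (y k) = ?L (\<lambda>i. h i + ?L (a k) i)"
      by (rule mat_vec_cong) (rule Suc.IH)
    then show ?case using Suc h by (simp add: step a mat_vec_linear)
  qed
  have lim: "(\<lambda>k. y k i) \<longlonglongrightarrow> h i" if "i \<in> I" for i
  proof -
    have "(\<lambda>k. ?L (a k) i) \<longlonglongrightarrow> 0"
    proof (rule gradient_descent_image_tendsto_0[where \<delta> = \<delta>])
      show "\<delta> < 2 / \<mu>" if "dot I v v = 1" "\<And>i. i \<notin> I \<Longrightarrow> v i = 0"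
        "\<And>i. i \<in> I \<Longrightarrow> mat_vec I A v i = \<mu> * v i" "0 < \<mu>" for \<mu> v
        using \<delta>(2) that by blast
    qed (use assms(1,2) \<delta>(1) a that in auto)
    then have "(\<lambda>k. h i + ?L (a k) i) \<longlonglongrightarrow> h i + 0" by (intro tendsto_intros)
    then show ?thesis using y[OF that] by simp
  qed
  have "y 0 i = h i + ?L u i" for i by (simp add: h_def)
  with lim h show ?thesis by blast
qed

section \<open>Walks, trees and boundaries\<close>

lemma is_walk_iff:
  "is_walk V F vs \<longleftrightarrow> vs \<noteq> [] \<and> set vs \<subseteq> V \<and> successively (\<lambda>x y. {x, y} \<in> F) vs"
  by (simp add: is_walk_def successively_conv_nth)

text \<open>
  If two paths from \<open>u\<close> to \<open>v\<close> begin with different edges, follow the first one up to the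
  first vertex \<open>w\<close> that lies on the second, and return to \<open>u\<close> along the second: this is a cycle.
\<close>

lemma acyclic_graph_path_unique:
  assumes "acyclic_graph V F"
  shows "is_path V F u p v \<Longrightarrow> is_path V F u q v \<Longrightarrow> p = q"
proof (induction p arbitrary: u q)
  case Nil
  then show ?case by (simp add: is_path_def is_walk_iff)
next
  case (Cons x p)
  from Cons.prems(1) have x: "x = u" by (simp add: is_path_def)
  from Cons.prems(2) obtain q' where q: "q = u # q'"
    by (cases q) (auto simp: is_path_def is_walk_iff)
  show ?case
  proof (cases "p = [] \<or> q' = []")
    case True
    \<comment> \<open>One path consists of \<open>u\<close> alone, and distinctness rules out a
      longer path that returns to \<open>u\<close>.\<close>
    then have "v = u" using Cons.prems q by (auto simp: is_path_def)
    then have "p = []" "q' = []"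
      using Cons.prems q x last_in_set[of p] last_in_set[of q']
      by (auto simp: is_path_def split: if_splits)
    then show ?thesis using q x by simp
  next
    case False
    then obtain a p' b q'' where p': "p = a # p'" and q'': "q' = b # q''"
      by (meson list.exhaust)
    have pa: "is_path V F a p v" and qb: "is_path V F b q' v"
      using Cons.prems unfolding q x p' q'' by (auto simp: is_path_def is_walk_iff)
    show ?thesis
    proof (cases "a = b")
      case True
      then show ?thesis using Cons.IH[OF pa] qb q x by blast
    next
      case ab: False
      have "last p \<in> set q'"
        using pa qb False last_in_set[of q'] by (simp add: is_path_def)
      then have "\<exists>w\<in>set p. w \<in> set q'"
        using False last_in_set[of p] by blast
      from split_list_first_propE[OF this] obtain p1 w p2
        where p1: "p = p1 @ w # p2" "w \<in> set q'" "\<forall>z\<in>set p1. z \<notin> set q'" .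
      from p1(2) obtain q1 q2 where q1: "q' = q1 @ w # q2"
        by (meson split_list)
      let ?c = "u # p1 @ w # rev q1"
      have wp: "is_walk V F (u # p1 @ w # p2)" and wq: "is_walk V F (u # q1 @ w # q2)"
        and dp: "distinct (u # p1 @ w # p2)" and dq: "distinct (u # q1 @ w # q2)"
        using Cons.prems by (auto simp: is_path_def q x p1(1) q1)
      have "successively (\<lambda>x y. {x, y} \<in> F) q1"
        using wq by (auto simp: is_walk_iff successively_append_iff successively_Cons)
      then have "successively (\<lambda>x y. {x, y} \<in> F) (rev q1)"
        by (simp add: insert_commute)
      moreover have "q1 \<noteq> [] \<Longrightarrow> {w, hd (rev q1)} \<in> F"
        using wq
        by (auto simp: is_walk_iff successively_append_iff successively_Cons hd_rev insert_commute)
      ultimately have "is_walk V F ?c"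
        using wp wq
        by (auto simp: is_walk_iff successively_append_iff successively_Cons hd_append split: if_splits)
      moreover have "distinct ?c"
        using dp dq p1(3) q1 by auto
      moreover have "3 \<le> length ?c"
      proof -
        \<comment> \<open>Otherwise \<open>w\<close> would be the second vertex of both paths,
          against \<open>a \<noteq> b\<close>.\<close>
        have "p1 \<noteq> [] \<or> q1 \<noteq> []"
          using ab p1(1) q1 p' q'' by auto
        then show ?thesis by (cases p1; cases q1) auto
      qed
      moreover have "{last ?c, hd ?c} \<in> F"
        using wq by (cases q1) (auto simp: is_walk_iff successively_Cons insert_commute)
      ultimately show ?thesis
        using assms unfolding acyclic_graph_def by blast
    qed
  qed
qed

text \<open>Connectedness gives existence and acyclicity uniqueness, so the definite description in
  \<open>tree_path\<close> denotes a path.\<close>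

lemma is_path_tree_path:
  assumes "is_spanning_tree V E F" "u \<in> V" "v \<in> V"
  shows "is_path V F u (tree_path V F u v) v"
proof -
  have "\<exists>!vs. is_path V F u vs v"
    using assms acyclic_graph_path_unique[of V F]
    unfolding is_spanning_tree_def connected_graph_def by blast
  then show ?thesis
    unfolding tree_path_def by (rule theI')
qed

section \<open>Path chains and boundary matrices in low dimension\<close>

lemma path_chain_singleton: "path_chain ord [a] = (\<lambda>_. 0)"
  by (simp add: path_chain_def)

lemma path_chain_pair:
  "path_chain ord [a, b] \<tau> = (if \<tau> = {a, b} then if ord \<tau> = [a, b] then 1 else -1 else 0)"
  by (simp add: path_chain_def)

lemma path_chain_Cons_Cons:
  "path_chain ord (a # b # vs) = (\<lambda>\<tau>. path_chain ord [a, b] \<tau> + path_chain ord (b # vs) \<tau>)"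
  by (simp add: path_chain_pair fun_eq_iff)
    (simp add: path_chain_def sum.lessThan_Suc_shift del: sum.lessThan_Suc cong: if_cong)

lemma simplices_0_iff: "\<tau> \<in> simplices X 0 \<longleftrightarrow> (\<exists>w\<in>vertices X. \<tau> = {w})"
  by (auto simp: simplices_def vertices_def card_1_singleton_iff)

lemma finite_simplices: "finite_simplicial_complex X \<Longrightarrow> finite (simplices X i)"
  by (simp add: finite_simplicial_complex_def simplices_def)

lemma face_in_simplices:
  assumes "finite_simplicial_complex X" "\<sigma> \<in> simplices X i" "\<tau> \<subseteq> \<sigma>" "card \<tau> = Suc j"
  shows "\<tau> \<in> simplices X j"
proof -
  have "\<tau> \<noteq> {}" using assms(4) by auto
  then show ?thesis
    using assms by (auto simp: finite_simplicial_complex_def simplices_def)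
qed

lemma orientation_edge:
  assumes "orientation X ord" "{a, b} \<in> edges X"
  shows "a \<noteq> b" "ord {a, b} = [a, b] \<or> ord {a, b} = [b, a]"
proof -
  show ne: "a \<noteq> b" using assms(2) by (auto simp: edges_def simplices_def)
  have o: "distinct (ord {a, b})" "set (ord {a, b}) = {a, b}"
    using assms(1)[unfolded orientation_def, rule_format, of 1] assms(2)
    by (simp_all add: edges_def)
  then have "length (ord {a, b}) = 2"
    using distinct_card[OF o(1)] ne by simp
  then obtain x y where "ord {a, b} = [x, y]"
    by (auto simp: length_Suc_conv numeral_2_eq_2)
  then show "ord {a, b} = [a, b] \<or> ord {a, b} = [b, a]"
    using o by (auto simp: doubleton_eq_iff)
qed

lemma ordered_simplex_singleton:
  assumes "orientation X ord" "v \<in> vertices X"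
  shows "ordered_simplex ord [v] = (\<lambda>\<tau>. if \<tau> = {v} then 1 else 0)"
proof -
  have o: "distinct (ord {v})" "set (ord {v}) = {v}"
    using assms by (auto simp: orientation_def simplices_def vertices_def)
  then have "length (ord {v}) = 1"
    using distinct_card[OF o(1)] by simp
  then have ov: "ord {v} = [v]"
    using o by (auto simp: length_Suc_conv)
  have "(THE p. p permutes {..<Suc 0} \<and> permute_list p (ord {v}) = [v]) = id"
    by (rule the_equality) (auto simp: ov lessThan_Suc permutes_sing)
  then show ?thesis by (intro ext) (simp add: ordered_simplex_def)
qed

lemma permutes_lessThan_Suc_Suc_0_iff:
  "p permutes {..<Suc (Suc 0)} \<longleftrightarrow> p = id \<or> p = Transposition.transpose 0 1"
proof -
  have "{..<Suc (Suc 0)} = {0, 1}" by auto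
  then show ?thesis using permutes_doubleton_iff[of p 0 "1 :: nat"] by simp
qed

text \<open>The sign of a permutation and the sign of a traversal agree: the identity or the
  transposition fits, according to the stored ordering. This turns the boundary of a triangle into
  path chains.\<close>

lemma ordered_simplex_pair:
  assumes "orientation X ord" "{a, b} \<in> edges X"
  shows "ordered_simplex ord [a, b] = path_chain ord [a, b]"
proof -
  note ne = orientation_edge(1)[OF assms]
  let ?P = "\<lambda>p. p permutes {..<Suc (Suc 0)} \<and> permute_list p (ord {a, b}) = [a, b]"
  from orientation_edge(2)[OF assms] show ?thesis
  proof
    assume o: "ord {a, b} = [a, b]"
    have "(THE p. ?P p) = id"
      by (rule the_equality)
        (use ne in \<open>auto simp: o permutes_lessThan_Suc_Suc_0_iff permute_list_def upt_rec\<close>)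
    then show ?thesis
      by (intro ext) (simp add: ordered_simplex_def path_chain_pair o)
  next
    assume o: "ord {a, b} = [b, a]"
    have "(THE p. ?P p) = Transposition.transpose 0 1"
      by (rule the_equality)
        (use ne in \<open>auto simp: o permutes_lessThan_Suc_Suc_0_iff permute_list_def upt_rec\<close>)
    then show ?thesis
      using ne by (intro ext) (simp add: ordered_simplex_def path_chain_pair o sign_swap_id)
  qed
qed

lemma boundary_matrix_edge:
  assumes "finite_simplicial_complex X" "orientation X ord" "{a, b} \<in> edges X" "ord {a, b} = [a, b]"
  shows "boundary_matrix ord 1 {w} {a, b} = of_bool (w = b) - of_bool (w = a)"
proof -
  have "a \<in> vertices X" "b \<in> vertices X"
    using face_in_simplices[OF assms(1), of "{a, b}" 1 "{_}" 0] assms(3)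
    by (auto simp: edges_def simplices_def vertices_def)
  then show ?thesis
    by (simp add: boundary_matrix_def assms(4) ordered_simplex_singleton[OF assms(2)])
qed

lemma boundary_path_chain_edge:
  assumes X: "finite_simplicial_complex X" "orientation X ord" and e: "{a, b} \<in> edges X"
  shows "(\<Sum>e\<in>edges X. boundary_matrix ord 1 {w} e * path_chain ord [a, b] e)
    = of_bool (w = b) - of_bool (w = a)"
proof -
  have fin: "finite (edges X)" using finite_simplices[OF X(1)] by (simp add: edges_def)
  let ?s = "if ord {a, b} = [a, b] then 1 else -1 :: real"
  have "(\<Sum>e\<in>edges X. boundary_matrix ord 1 {w} e * path_chain ord [a, b] e)
    = (\<Sum>e\<in>edges X. if e = {a, b} then boundary_matrix ord 1 {w} {a, b} * ?s else 0)"
    by (rule sum.cong) (auto simp: path_chain_def)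
  also have "\<dots> = boundary_matrix ord 1 {w} {a, b} * ?s"
    using fin e by simp
  \<comment> \<open>If \<open>ord\<close> stores the edge as \<open>[b, a]\<close>, the matrix entry
    and the coefficient \<open>?s\<close> both change sign.\<close>
  also have "\<dots> = of_bool (w = b) - of_bool (w = a)"
    using orientation_edge[OF X(2) e] boundary_matrix_edge[OF X e]
      boundary_matrix_edge[OF X, of b a] e by (auto simp: insert_commute)
  finally show ?thesis .
qed

text \<open>The edge contributions telescope along the walk, so a closed walk has boundary
  0.\<close>

lemma boundary_path_chain:
  assumes X: "finite_simplicial_complex X" "orientation X ord"
    and "vs \<noteq> []" "successively (\<lambda>x y. {x, y} \<in> edges X) vs"
  shows "(\<Sum>e\<in>edges X. boundary_matrix ord 1 {w} e * path_chain ord vs e)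
    = of_bool (w = last vs) - of_bool (w = hd vs)"
  using assms(3,4)
proof (induction vs rule: induct_list012)
  case (2 x)
  then show ?case by (simp add: path_chain_singleton)
next
  case (3 a b vs)
  then show ?case
    using boundary_path_chain_edge[OF X, of a b w]
    by (simp add: path_chain_Cons_Cons[of ord a b vs] distrib_left sum.distrib)
qed simp

text \<open>The identity \<open>\<partial>\<^sub>1 \<partial>\<^sub>2 = 0\<close> in matrix form:
  the faces of a triangle are single-edge path chains, whose endpoint terms cancel.\<close>

lemma boundary_boundary_matrix:
  assumes X: "finite_simplicial_complex X" "orientation X ord"
    and \<sigma>: "\<sigma> \<in> simplices X 2"
  shows "(\<Sum>e\<in>edges X. boundary_matrix ord 1 {w} e * boundary_matrix ord 2 e \<sigma>) = 0"
proof -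
  have o: "distinct (ord \<sigma>)" "set (ord \<sigma>) = \<sigma>"
    using X(2) \<sigma> by (auto simp: orientation_def)
  then have "length (ord \<sigma>) = 3"
    using distinct_card[OF o(1)] \<sigma> by (simp add: simplices_def)
  then obtain a b c where abc: "ord \<sigma> = [a, b, c]"
    by (auto simp: length_Suc_conv numeral_3_eq_3)
  have e: "{a, b} \<in> edges X" "{b, c} \<in> edges X" "{a, c} \<in> edges X"
    using o abc by (auto simp: edges_def intro!: face_in_simplices[OF X(1) \<sigma>])
  let ?b = "\<lambda>e. boundary_matrix ord 1 {w} e" and ?c = "path_chain ord"
  have "boundary_matrix ord 2 e \<sigma> = ?c [b, c] e - ?c [a, c] e + ?c [a, b] e" for e
    using e by (simp add: boundary_matrix_def abc numeral_2_eq_2 ordered_simplex_pair[OF X(2)])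
  then have "(\<Sum>e\<in>edges X. ?b e * boundary_matrix ord 2 e \<sigma>)
      = (\<Sum>e\<in>edges X. ?b e * ?c [b, c] e) - (\<Sum>e\<in>edges X. ?b e * ?c [a, c] e)
        + (\<Sum>e\<in>edges X. ?b e * ?c [a, b] e)"
    by (simp only: distrib_left right_diff_distrib sum.distrib sum_subtractf)
  also have "\<dots> = 0"
    unfolding boundary_path_chain_edge[OF X e(1)] boundary_path_chain_edge[OF X e(2)]
      boundary_path_chain_edge[OF X e(3)] by simp
  finally show ?thesis .
qed

lemma path_chain_in_chain_space:
  assumes "successively (\<lambda>x y. {x, y} \<in> edges X) vs"
  shows "path_chain ord vs \<in> chain_space X 1"
  using assms
  by (auto simp: path_chain_def chain_space_def edges_def successively_conv_nth intro!: sum.neutral)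

text \<open>The closed walk serves to show that a fundamental cycle lies in
  \<open>chain_space X 1\<close> and has boundary 0.\<close>

lemma fundamental_cycle_closed_walk:
  assumes X: "finite_simplicial_complex X" "orientation X ord"
    and T: "is_spanning_tree (vertices X) (edges X) F" "r \<in> vertices X"
    and e: "e \<in> edges X"
  obtains vs where "fundamental_cycle X ord F r e = path_chain ord vs" "vs \<noteq> []"
    "successively (\<lambda>x y. {x, y} \<in> edges X) vs" "hd vs = last vs"
proof -
  have "card e = 2" using e by (simp add: edges_def simplices_def)
  then obtain x y where xy: "e = {x, y}" "x \<noteq> y" by (auto simp: card_2_iff)
  then obtain a b where ab: "e = {a, b}" "ord e = [a, b]"
    using orientation_edge(2)[OF X(2), of x y] e by (metis insert_commute)
  have V: "a \<in> vertices X" "b \<in> vertices X"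
    using face_in_simplices[OF X(1), of e 1 "{_}" 0] e ab(1)
    by (auto simp: edges_def simplices_def vertices_def)
  let ?p = "tree_path (vertices X) F r a" and ?q = "tree_path (vertices X) F b r"
  have "F \<subseteq> edges X" using T(1) by (simp add: is_spanning_tree_def)
  then have succ: "successively (\<lambda>x y. {x, y} \<in> edges X) vs"
    if "is_path (vertices X) F u vs v" for u vs v
    using that by (auto simp: is_path_def is_walk_iff elim: successively_mono)
  note p = is_path_tree_path[OF T(1,2) V(1)] and q = is_path_tree_path[OF T(1) V(2) T(2)]
  have "?p \<noteq> []" "?q \<noteq> []"
    using p q by (auto simp: is_path_def is_walk_iff)
  \<comment> \<open>The two tree paths are joined by the edge \<open>e\<close> from \<open>a\<close>
    to \<open>b\<close>.\<close>
  moreover have "successively (\<lambda>x y. {x, y} \<in> edges X) (?p @ ?q)"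
    using succ[OF p] succ[OF q] p q e ab(1)
    by (auto simp: successively_append_iff is_path_def)
  ultimately show thesis
    using p q by (intro that[of "?p @ ?q"]) (simp_all add: fundamental_cycle_def ab(2) is_path_def)
qed

section \<open>Linear combinations of independent random variables\<close>

text \<open>Independence makes the joint law a product. For a fixed value \<open>s\<close> of
  \<open>S\<close> the sum vanishes only at \<open>y = - s\<close>, a null set for the law of
  \<open>Y\<close>, and Fubini's theorem does the rest.\<close>

lemma (in prob_space) indep_var_AE_sum_neq_0:
  fixes Y S :: "'a \<Rightarrow> real"
  assumes indep: "indep_var borel Y borel S"
    and no_atoms: "\<And>t. AE y in distr M borel Y. y \<noteq> t"
  shows "AE \<omega> in M. Y \<omega> + S \<omega> \<noteq> 0"
proof -
  let ?Y = "distr M borel Y" and ?S = "distr M borel S"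
  have rv [measurable]: "random_variable borel Y" "random_variable borel S"
    and eq: "?Y \<Otimes>\<^sub>M ?S = distr M (borel \<Otimes>\<^sub>M borel) (\<lambda>\<omega>. (Y \<omega>, S \<omega>))"
    using indep indep_var_distribution_eq by blast+
  interpret Y: prob_space ?Y by (rule prob_space_distr) simp
  interpret S: prob_space ?S by (rule prob_space_distr) simp
  interpret pair_sigma_finite ?Y ?S ..
  have meas: "{z \<in> space (borel \<Otimes>\<^sub>M borel). fst z + snd z \<noteq> (0 :: real)} \<in> sets (borel \<Otimes>\<^sub>M borel)"
    by measurable
  then have meas': "{z \<in> space (?Y \<Otimes>\<^sub>M ?S). fst z + snd z \<noteq> 0} \<in> sets (?Y \<Otimes>\<^sub>M ?S)"
    by (simp add: space_pair_measure cong: sets_pair_measure_cong)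
  have "AE y in ?Y. y + s \<noteq> 0" for s
    using no_atoms[of "- s"] by eventually_elim auto
  then have "AE s in ?S. AE y in ?Y. y + s \<noteq> 0" by simp
  \<comment> \<open>The passage to the product measure quantifies over \<open>y\<close> first,
    whereas the absence of atoms is used for fixed \<open>s\<close>.\<close>
  then have "AE y in ?Y. AE s in ?S. y + s \<noteq> 0"
    by (subst AE_commute) (use meas' in simp_all)
  then have "AE z in ?Y \<Otimes>\<^sub>M ?S. fst z + snd z \<noteq> 0"
    by (intro AE_pair_measure meas') simp
  then show ?thesis
    unfolding eq using meas by (subst (asm) AE_distr_iff) auto
qed

text \<open>The term of an index with nonzero coefficient has no atoms and is independent of the sum
  of the others.\<close>

lemma (in prob_space) indep_vars_AE_linear_combination_neq_0:
  fixes Y :: "'i \<Rightarrow> 'a \<Rightarrow> real"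
  assumes "finite I" "indep_vars (\<lambda>_. borel) Y I"
    and no_atoms: "\<And>i t. i \<in> I \<Longrightarrow> AE y in distr M borel (Y i). y \<noteq> t"
    and "i \<in> I" "g i \<noteq> 0"
  shows "AE \<omega> in M. (\<Sum>i\<in>I. Y i \<omega> * g i) \<noteq> 0"
proof -
  have I: "insert i (I - {i}) = I" using \<open>i \<in> I\<close> by auto
  have rv [measurable]: "random_variable borel (Y i)"
    using assms(2,4) by (auto simp: indep_vars_def)
  have "indep_vars (\<lambda>_. borel) (\<lambda>i \<omega>. Y i \<omega> * g i) I"
    by (rule indep_vars_compose2[OF assms(2)]) simp
  then have indep: "indep_var borel (\<lambda>\<omega>. Y i \<omega> * g i) borel (\<lambda>\<omega>. \<Sum>i\<in>I - {i}. Y i \<omega> * g i)"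
    using indep_vars_sum[of "I - {i}" i "\<lambda>i \<omega>. Y i \<omega> * g i"] assms(1) I by simp
  have "AE y in distr M borel (\<lambda>\<omega>. Y i \<omega> * g i). y \<noteq> t" for t
  proof -
    have "AE y in distr M borel (Y i). y \<noteq> t / g i"
      by (rule no_atoms[OF assms(4)])
    then have "AE \<omega> in M. Y i \<omega> \<noteq> t / g i"
      by (subst (asm) AE_distr_iff) auto
    then have "AE \<omega> in M. Y i \<omega> * g i \<noteq> t"
      by eventually_elim (use assms(5) in \<open>auto simp: field_simps\<close>)
    then show ?thesis
      by (subst AE_distr_iff) auto
  qed
  from indep_var_AE_sum_neq_0[OF indep this] show ?thesis
    by (simp add: sum.remove[OF assms(1,4)])
qed

text \<open>The uniform law has a density, and points are Lebesgue null sets.\<close>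

lemma AE_uniform_measure_lborel_neq:
  fixes a b t :: real
  shows "AE y in uniform_measure lborel {a..b}. y \<noteq> t"
proof -
  have "absolutely_continuous lborel (uniform_measure lborel {a..b})"
    unfolding uniform_measure_def by (rule absolutely_continuousI_density) simp
  then show ?thesis
    by (rule absolutely_continuous_AE[rotated]) (auto intro: AE_lborel_singleton)
qed

section \<open>The Laplacian and the harmonic part of a cycle\<close>

text \<open>The matrix \<open>B B\<^sup>T\<close>. Both summands of \<open>L\<^sub>1\<close> are of
  this form, with \<open>B\<close> the matrix of \<open>\<partial>\<^sub>2\<close> or the transpose
  of that of \<open>\<partial>\<^sub>1\<close>.\<close>

definition gram :: "'j set \<Rightarrow> ('i \<Rightarrow> 'j \<Rightarrow> real) \<Rightarrow> 'i \<Rightarrow> 'i \<Rightarrow> real" where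
  "gram J B i i' = (\<Sum>j\<in>J. B i j * B i' j)"

lemma mat_vec_gram: "mat_vec I (gram J B) x = mat_vec J B (mat_vec I (\<lambda>j i. B i j) x)"
proof
  fix i
  have "mat_vec I (gram J B) x i = (\<Sum>i'\<in>I. \<Sum>j\<in>J. B i j * (B i' j * x i'))"
    by (simp add: mat_vec_def gram_def sum_distrib_right mult.assoc)
  also have "\<dots> = (\<Sum>j\<in>J. \<Sum>i'\<in>I. B i j * (B i' j * x i'))"
    by (rule sum.swap)
  also have "\<dots> = mat_vec J B (mat_vec I (\<lambda>j i. B i j) x) i"
    by (simp add: mat_vec_def sum_distrib_left)
  finally show "mat_vec I (gram J B) x i = mat_vec J B (mat_vec I (\<lambda>j i. B i j) x) i" .
qed

lemma dot_mat_vec_gram: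
  "dot I x (mat_vec I (gram J B) x)
    = dot J (mat_vec I (\<lambda>j i. B i j) x) (mat_vec I (\<lambda>j i. B i j) x)"
  by (simp add: mat_vec_gram dot_mat_vec)

definition laplacian_matrix ::
  "'a set set \<Rightarrow> ('a set \<Rightarrow> 'a list) \<Rightarrow> 'a set \<Rightarrow> 'a set \<Rightarrow> real" where
  "laplacian_matrix X ord e f = gram (simplices X 2) (boundary_matrix ord 2) e f
     + gram (simplices X 0) (\<lambda>e \<tau>. boundary_matrix ord 1 \<tau> e) e f"

section \<open>The matrix of \<open>L\<^sub>1\<close> and its energy\<close>

lemma mat_vec_laplacian_matrix:
  "mat_vec I (laplacian_matrix X ord) x e
    = mat_vec I (gram (simplices X 2) (boundary_matrix ord 2)) x e
      + mat_vec I (gram (simplices X 0) (\<lambda>e \<tau>. boundary_matrix ord 1 \<tau> e)) x e"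
  by (simp add: mat_vec_def laplacian_matrix_def distrib_right sum.distrib)

text \<open>This energy identity gives semidefiniteness, and also shows that a harmonic chain is
  annihilated by \<open>\<partial>\<^sub>2\<^sup>T\<close>, hence orthogonal to
  \<open>B\<close>.\<close>

lemma dot_laplacian_matrix:
  "dot I x (mat_vec I (laplacian_matrix X ord) x)
    = dot (simplices X 2) (mat_vec I (\<lambda>\<sigma> e. boundary_matrix ord 2 e \<sigma>) x)
        (mat_vec I (\<lambda>\<sigma> e. boundary_matrix ord 2 e \<sigma>) x)
      + dot (simplices X 0) (mat_vec I (boundary_matrix ord 1) x) (mat_vec I (boundary_matrix ord 1) x)"
  unfolding mat_vec_laplacian_matrix dot_add_right dot_mat_vec_gram ..

lemma sym_psd_laplacian_matrix: "sym_psd I (laplacian_matrix X ord)"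
  unfolding sym_psd_def dot_laplacian_matrix
  by (auto simp: laplacian_matrix_def gram_def mult.commute intro!: add_nonneg_nonneg dot_self_nonneg)

lemma boundary_2_eq:
  "boundary X ord 2 z e
    = (if e \<in> edges X then mat_vec (simplices X 2) (boundary_matrix ord 2) z e else 0)"
  by (simp add: boundary_def mat_vec_def edges_def)

lemma laplacian1_eq:
  "laplacian1 X ord x e = (if e \<in> edges X then mat_vec (edges X) (laplacian_matrix X ord) x e else 0)"
proof -
  have "mat_vec (simplices X 2) (boundary_matrix ord 2) (boundary_transpose X ord 2 x)
      = mat_vec (simplices X 2) (boundary_matrix ord 2)
          (mat_vec (edges X) (\<lambda>\<sigma> e. boundary_matrix ord 2 e \<sigma>) x)"
    by (rule mat_vec_cong) (simp add: boundary_transpose_def mat_vec_def edges_def)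
  moreover have "boundary_transpose X ord 1 (boundary X ord 1 x) e
      = (if e \<in> edges X then mat_vec (simplices X 0) (\<lambda>e \<tau>. boundary_matrix ord 1 \<tau> e)
          (mat_vec (edges X) (boundary_matrix ord 1) x) e else 0)"
    by (simp add: boundary_transpose_def boundary_def mat_vec_def edges_def)
  ultimately show ?thesis
    by (simp add: laplacian1_def boundary_2_eq mat_vec_laplacian_matrix mat_vec_gram)
qed

text \<open>Deterministic in the starting vector \<open>x\<close>, so that probability enters only
  at the very end.\<close>

lemma generated_harmonic_decomposition:
  assumes X: "finite_simplicial_complex X"
    and \<delta>: "0 < \<delta>" "\<And>\<mu>. laplacian1_eigenvalue X ord \<mu> \<Longrightarrow> 0 < \<mu> \<Longrightarrow> \<delta> < 2 / \<mu>"
  shows "\<exists>u. \<forall>e\<in>edges X.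
    mat_vec (edges X) (laplacian_matrix X ord) (generated_harmonic X ord \<delta> x) e = 0 \<and>
    x e = generated_harmonic X ord \<delta> x e + mat_vec (edges X) (laplacian_matrix X ord) u e"
proof -
  let ?E = "edges X" and ?L = "mat_vec (edges X) (laplacian_matrix X ord)"
  have fin: "finite ?E" using finite_simplices[OF X] by (simp add: edges_def)
  have "\<exists>h u. \<forall>e\<in>?E. (\<lambda>k. laplacian1_iterate X ord \<delta> x k e) \<longlonglongrightarrow> h e \<and> ?L h e = 0 \<and>
      laplacian1_iterate X ord \<delta> x 0 e = h e + ?L u e"
  proof (rule gradient_descent_limit[OF fin sym_psd_laplacian_matrix \<delta>(1)])
    show "\<delta> < 2 / \<mu>"
      if v: "dot ?E v v = 1" "\<And>i. i \<notin> ?E \<Longrightarrow> v i = 0" "\<And>i. i \<in> ?E \<Longrightarrow> ?L v i = \<mu> * v i"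
        and "0 < \<mu>" for \<mu> v
    proof -
      \<comment> \<open>Unit length excludes the zero vector, and vanishing off the edges makes
        \<open>v\<close> a chain, as the notion of eigenvalue demands.\<close>
      have "v \<noteq> (\<lambda>_. 0)" using v(1) by (auto simp: dot_def)
      moreover have "v \<in> chain_space X 1" using v(2) by (simp add: chain_space_def edges_def)
      moreover have "laplacian1 X ord v = (\<lambda>e. \<mu> * v e)"
        using v(2,3) by (auto simp: laplacian1_eq)
      ultimately have "laplacian1_eigenvalue X ord \<mu>"
        unfolding laplacian1_eigenvalue_def by blast
      then show ?thesis using \<delta>(2) \<open>0 < \<mu>\<close> by blast
    qed
  qed (simp_all add: laplacian1_eq)
  then obtain h u where h: "\<And>e. e \<in> ?E \<Longrightarrow> (\<lambda>k. laplacian1_iterate X ord \<delta> x k e) \<longlonglongrightarrow> h e"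
      "\<And>e. e \<in> ?E \<Longrightarrow> ?L h e = 0" "\<And>e. e \<in> ?E \<Longrightarrow> x e = h e + ?L u e"
    by auto
  have eq: "generated_harmonic X ord \<delta> x e = h e" if "e \<in> ?E" for e
    using limI[OF h(1)[OF that]] by (simp add: generated_harmonic_def)
  have "?L (generated_harmonic X ord \<delta> x) = ?L h"
    by (rule mat_vec_cong) (rule eq)
  then show ?thesis
    using h(2,3) eq by auto
qed

text \<open>The witness \<open>g\<close> is the component of the cycle \<open>c\<close> orthogonal to the image of \<open>\<partial>\<^sub>2\<close>.\<close>

lemma cycle_harmonic_part:
  assumes X: "finite_simplicial_complex X" "orientation X ord"
    and \<delta>: "0 < \<delta>" "\<And>\<mu>. laplacian1_eigenvalue X ord \<mu> \<Longrightarrow> 0 < \<mu> \<Longrightarrow> \<delta> < 2 / \<mu>"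
    and c: "c \<in> chain_space X 1"
      "\<And>\<tau>. \<tau> \<in> simplices X 0 \<Longrightarrow> mat_vec (edges X) (boundary_matrix ord 1) c \<tau> = 0"
  shows "\<exists>g. (\<forall>x. inner_chains X (generated_harmonic X ord \<delta> x) c = dot (edges X) x g) \<and>
    (c \<in> contractible_chains X ord \<longleftrightarrow> (\<forall>e\<in>edges X. g e = 0))"
proof -
  let ?E = "edges X" and ?L = "mat_vec (edges X) (laplacian_matrix X ord)"
  let ?B1 = "boundary_matrix ord 1" and ?B2 = "boundary_matrix ord 2"
  let ?D2 = "mat_vec (simplices X 2) ?B2" and ?D2T = "mat_vec (edges X) (\<lambda>\<sigma> e. ?B2 e \<sigma>)"
  have fin: "finite ?E" "finite (simplices X i)" for i
    using finite_simplices[OF X(1)] by (auto simp: edges_def)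
  obtain z where z: "\<And>\<sigma>. \<sigma> \<in> simplices X 2 \<Longrightarrow> dot ?E (\<lambda>e. ?B2 e \<sigma>) (\<lambda>e. c e - ?D2 z e) = 0"
    using normal_equations[OF fin(1,2)] by blast
  define g where "g = (\<lambda>e. c e - ?D2 z e)"
  have g2: "?D2T g \<sigma> = 0" if "\<sigma> \<in> simplices X 2" for \<sigma>
    using z[OF that] by (simp add: g_def dot_def mat_vec_def)
  have g1: "mat_vec ?E ?B1 g \<tau> = 0" if "\<tau> \<in> simplices X 0" for \<tau>
  proof -
    obtain w where w: "\<tau> = {w}" using \<open>\<tau> \<in> simplices X 0\<close> by (auto simp: simplices_0_iff)
    \<comment> \<open>Moving \<open>\<partial>\<^sub>2\<close> across to the row of
      \<open>\<partial>\<^sub>1\<close> at \<open>\<tau>\<close> exposes the entries of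
      \<open>\<partial>\<^sub>1 \<partial>\<^sub>2\<close>.\<close>
    have "mat_vec ?E ?B1 (?D2 z) \<tau> = dot ?E (?B1 \<tau>) (?D2 z)"
      by (simp add: mat_vec_def dot_def)
    also have "\<dots> = dot (simplices X 2) (?D2T (?B1 \<tau>)) z"
      by (rule dot_mat_vec)
    also have "\<dots> = dot (simplices X 2) (\<lambda>_. 0) z"
      using boundary_boundary_matrix[OF X]
      by (intro dot_cong) (simp_all add: mat_vec_def w mult.commute)
    finally have "mat_vec ?E ?B1 (?D2 z) \<tau> = 0" by (simp add: dot_def)
    then show ?thesis using c(2)[OF that] by (simp add: g_def mat_vec_diff)
  qed
  have D2_ortho: "dot ?E v (?D2 w) = 0" if "\<And>\<sigma>. \<sigma> \<in> simplices X 2 \<Longrightarrow> ?D2T v \<sigma> = 0" for v w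
    using that by (simp add: dot_mat_vec) (simp add: dot_def)
  have Lg: "?L g e = 0" for e
    unfolding mat_vec_laplacian_matrix mat_vec_gram
    using g1 g2 by (simp add: mat_vec_def)
  have pairing: "inner_chains X (generated_harmonic X ord \<delta> x) c = dot ?E x g" for x
  proof -
    define h where "h = generated_harmonic X ord \<delta> x"
    obtain u where h: "\<And>e. e \<in> ?E \<Longrightarrow> ?L h e = 0" "\<And>e. e \<in> ?E \<Longrightarrow> x e = h e + ?L u e"
      unfolding h_def using generated_harmonic_decomposition[where x = x, OF X(1) \<delta>] by blast
    have "dot ?E h (?L h) = 0" using h(1) by (simp add: dot_def)
    then have "dot (simplices X 2) (?D2T h) (?D2T h) = 0"
      unfolding dot_laplacian_matrix using dot_self_nonneg by (smt (verit))
    then have "?D2T h \<sigma> = 0" if "\<sigma> \<in> simplices X 2" for \<sigma>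
      using that dot_self_eq_0_iff[OF fin(2)] by blast
    then have "dot ?E h (?D2 z) = 0" by (rule D2_ortho)
    then have "dot ?E h c = dot ?E h g" by (simp add: g_def dot_linear)
    moreover have "dot ?E x g = dot ?E (\<lambda>e. h e + ?L u e) g"
      by (rule dot_cong) (auto simp: h(2))
    moreover have "dot ?E (?L u) g = dot ?E u (?L g)"
      by (rule sym_psd_dot_mat_vec[OF sym_psd_laplacian_matrix, symmetric])
    then have "dot ?E (?L u) g = 0" by (simp add: Lg dot_def)
    ultimately show ?thesis by (simp add: h_def inner_chains_def dot_def dot_add_left[unfolded dot_def])
  qed
  have "c \<in> contractible_chains X ord \<longleftrightarrow> (\<forall>e\<in>?E. g e = 0)"
  proof
    assume "c \<in> contractible_chains X ord"
    then obtain z' where z': "c = boundary X ord 2 z'" by (auto simp: contractible_chains_def)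
    \<comment> \<open>Here \<open>g\<close> lies in the image of \<open>\<partial>\<^sub>2\<close>
      and is orthogonal to it.\<close>
    have "dot ?E g g = dot ?E g (?D2 (\<lambda>\<sigma>. z' \<sigma> - z \<sigma>))"
      by (rule dot_cong) (simp_all add: g_def z' boundary_2_eq mat_vec_diff)
    also have "\<dots> = 0" using g2 by (rule D2_ortho)
    finally show "\<forall>e\<in>?E. g e = 0" using dot_self_eq_0_iff[OF fin(1)] by blast
  next
    assume g0: "\<forall>e\<in>?E. g e = 0"
    \<comment> \<open>The normal equations leave \<open>z\<close> unconstrained off the triangles,
      so it is cut off there to become a 2-chain.\<close>
    let ?z = "\<lambda>\<sigma>. if \<sigma> \<in> simplices X 2 then z \<sigma> else 0"
    have "?D2 ?z = ?D2 z" by (rule mat_vec_cong) simp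
    then have "c = boundary X ord 2 ?z"
      using g0 c(1) by (auto simp: fun_eq_iff boundary_2_eq g_def chain_space_def edges_def)
    moreover have "?z \<in> chain_space X 2" by (simp add: chain_space_def)
    ultimately show "c \<in> contractible_chains X ord"
      unfolding contractible_chains_def by blast
  qed
  with pairing show ?thesis by blast
qed

theorem theorem4p1:
  fixes X :: "'a set set"
    and ord :: "'a set \<Rightarrow> 'a list"
    and E_T :: "'a set set"
    and v_r :: 'a
    and M :: "'w measure"
    and y0 :: "'w \<Rightarrow> 'a set \<Rightarrow> real"
    and \<delta> :: real
    and c :: "'a set \<Rightarrow> real"
  assumes "finite_simplicial_complex X"
    and "orientation X ord"
    and "connected_graph (vertices X) (edges X)"
    and "edges X \<noteq> {}"
    and "is_spanning_tree (vertices X) (edges X) E_T"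
    and "v_r \<in> vertices X"
    and "prob_space M"
    and "\<And>\<omega>. \<omega> \<in> space M \<Longrightarrow> y0 \<omega> \<in> chain_space X 1"
    and "prob_space.indep_vars M (\<lambda>_. borel) (\<lambda>e \<omega>. y0 \<omega> e) (edges X)"
    and "\<And>e. e \<in> edges X \<Longrightarrow>
           distr M borel (\<lambda>\<omega>. y0 \<omega> e) = uniform_measure lborel {-0.5..0.5}"
    and "0 < \<delta>"
    and "\<And>\<mu>. laplacian1_eigenvalue X ord \<mu> \<Longrightarrow> 0 < \<mu> \<Longrightarrow> \<delta> < 2 / \<mu>"
    and "c \<in> fundamental_cycles X ord E_T v_r"
  shows "AE \<omega> in M. c \<in> contractible_chains X ord \<longleftrightarrow>
           inner_chains X (generated_harmonic X ord \<delta> (y0 \<omega>)) c = 0"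
proof -
  interpret prob_space M by fact
  note X = assms(1,2)
  have fin: "finite (edges X)" using finite_simplices[OF X(1)] by (simp add: edges_def)
  obtain e where e: "e \<in> edges X" "c = fundamental_cycle X ord E_T v_r e"
    using assms(13) by (auto simp: fundamental_cycles_def)
  obtain vs where vs: "c = path_chain ord vs" "vs \<noteq> []"
      "successively (\<lambda>x y. {x, y} \<in> edges X) vs" "hd vs = last vs"
    using fundamental_cycle_closed_walk[OF X assms(5,6) e(1)] e(2) by metis
  have c: "c \<in> chain_space X 1"
    unfolding vs(1) by (rule path_chain_in_chain_space[OF vs(3)])
  have dc: "mat_vec (edges X) (boundary_matrix ord 1) c \<tau> = 0" if "\<tau> \<in> simplices X 0" for \<tau>
    using that boundary_path_chain[OF X vs(2,3)] vs(4)
    by (auto simp: simplices_0_iff mat_vec_def vs(1))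
  \<comment> \<open>\<open>g\<close> is chosen before the starting vector, so a single fixed linear
    form is evaluated at all outcomes.\<close>
  obtain g where g: "\<And>x. inner_chains X (generated_harmonic X ord \<delta> x) c = dot (edges X) x g"
    "c \<in> contractible_chains X ord \<longleftrightarrow> (\<forall>e\<in>edges X. g e = 0)"
    using cycle_harmonic_part[OF X assms(11,12) c dc] by blast
  show ?thesis
  proof (cases "c \<in> contractible_chains X ord")
    \<comment> \<open>Here the pairing vanishes for every outcome; only the other case needs
      probability.\<close>
    case True
    then have "dot (edges X) (y0 \<omega>) g = 0" for \<omega>
      using g(2) by (simp add: dot_def)
    then show ?thesis using True by (simp add: g(1))
  next
    case False
    then obtain f where f: "f \<in> edges X" "g f \<noteq> 0" using g(2) by blast
    have no_atoms: "AE y in distr M borel (\<lambda>\<omega>. y0 \<omega> e). y \<noteq> t" if "e \<in> edges X" for e t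
      unfolding assms(10)[OF that] by (rule AE_uniform_measure_lborel_neq)
    have "AE \<omega> in M. dot (edges X) (y0 \<omega>) g \<noteq> 0"
      unfolding dot_def
      using indep_vars_AE_linear_combination_neq_0[where g = g, OF fin assms(9) no_atoms f] .
    then show ?thesis using False by (simp add: g(1))
  qed
qed

end
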